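(* Let $(X,d)$ be a Hadamard space, let $m$ be a positive integer, and let $f : X \to (-\infty,+\infty]$ be a proper lower semicontinuous convex function. Let $R_{\lambda_i,f} : X \to X$ be the resolvent mapping of $f$ with respect to $\lambda_i > 0$ for all $i \in \{1,2,\dots,m\}$. If $\operatorname{arg\,min}_X f \neq \emptyset$, then for any initial point $x_0 \in X$, the sequence defined for each $n \in \mathbb{N}$ by $$x_n := (R_{\lambda_m,f} R_{\lambda_{m-1},f} \cdots R_{\lambda_1,f})^n(x_0)$$ is $\Delta$-convergent to an element $x^\ast$ in $\operatorname{arg\,min}_X f$.
   Context: A Hadamard space is a complete $\mathrm{CAT}(0)$ space. For $x,y \in X$ and $t \in [0,1]$, $(1-t)x \oplus ty$ denotes the point $\gamma(t)$, where $\gamma : [0,1] \to X$ is the unique geodesic with $\gamma(0)=x$, $\gamma(1)=y$, $d(\gamma(t),\gamma(s)) = d(x,y)|t-s|$. A function $f : X \to (-\infty,+\infty]$ is proper if $\{x \in X : f(x) < +\infty\} \ne \emptyset$; lower semicontinuous if $f(u) \le \liminf_{n} f(u_n)$ whenever $u_n \to u$; convex if $f((1-t)x \oplus ty) \le (1-t)f(x) + tf(y)$ for all $x,y\in X$, $t \in (0,1)$. $\operatorname{arg\,min}_X f$ is the set of minimizers of $f$ on $X$. For $\lambda > 0$ the resolvent of a proper lower semicontinuous convex function $f$ is $R_{\lambda,f}(x) = \operatorname{arg\,min}_{y \in X}\{ f(y) + \frac{1}{2\lambda} d(x,y)^2 \}$ for $x \in X$, which is well defined as a single-valued mapping $X \to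 X$. Products of mappings denote composition (rightmost applied first), and the power $n$ denotes the $n$-th iterate. For a bounded sequence $\{x_n\}$ in $X$, the asymptotic center is $\mathcal{A}(\{x_n\}) = \{ z \in X : \limsup_{n} d(z,x_n) = \inf_{y \in X} \limsup_{n} d(y,x_n)\}$ (a singleton in a Hadamard space). A bounded sequence $\{x_n\}$ is $\Delta$-convergent to $z \in X$ if $\mathcal{A}(\{x_{n_i}\}) = \{z\}$ for each subsequence $\{x_{n_i}\}$ of $\{x_n\}$. *)

theory Defs
  imports "HOL-Analysis.Analysis"
begin

text \<open>Geodesics are parametrised on \<open>[0,1]\<close>, proportionally to arc length; values outside
  \<open>[0,1]\<close> are irrelevant.\<close>

definition (in metric_space) geodesic :: "(real \<Rightarrow> 'a) \<Rightarrow> 'a \<Rightarrow> 'a \<Rightarrow> bool"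
  where "geodesic \<gamma> x y \<longleftrightarrow> \<gamma> 0 = x \<and> \<gamma> 1 = y \<and>
    (\<forall>s\<in>{0..1}. \<forall>t\<in>{0..1}. dist (\<gamma> t) (\<gamma> s) = dist x y * \<bar>t - s\<bar>)"

definition (in metric_space) geodesic_segment :: "'a set \<Rightarrow> 'a \<Rightarrow> 'a \<Rightarrow> bool"
  where "geodesic_segment S x y \<longleftrightarrow> (\<exists>\<gamma>. geodesic \<gamma> x y \<and> S = \<gamma> ` {0..1})"

text \<open>\<open>u'\<close> is a comparison point, on the side \<open>[x',y']\<close> of a comparison triangle in the
  Euclidean plane, of the point \<open>u\<close> on the side \<open>S\<close> from \<open>x\<close> to \<open>y\<close>.\<close>

definition (in metric_space) comparison_point ::
    "'a set \<Rightarrow> 'a \<Rightarrow> real^2 \<Rightarrow> real^2 \<Rightarrow> 'a \<Rightarrow> real^2 \<Rightarrow> bool"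
  where "comparison_point S x x' y' u u' \<longleftrightarrow>
    u \<in> S \<and> u' \<in> closed_segment x' y' \<and> dist x' u' = dist x u"

text \<open>Every geodesic triangle is at least as thin as its comparison triangles.\<close>

class hadamard_space = complete_space +
  assumes geodesic_exists: "\<exists>\<gamma>. geodesic \<gamma> x y"
  assumes CAT0_inequality:
    "\<lbrakk>geodesic_segment S1 p q; geodesic_segment S2 q r; geodesic_segment S3 r p;
      dist p' q' = dist p q; dist q' r' = dist q r; dist r' p' = dist r p;
      comparison_point S1 p p' q' u u' \<or> comparison_point S2 q q' r' u u' \<or>
        comparison_point S3 r r' p' u u';
      comparison_point S1 p p' q' v v' \<or> comparison_point S2 q q' r' v v' \<or>
        comparison_point S3 r r' p' v v'\<rbrakk>
     \<Longrightarrow> dist u v \<le> dist u' v'"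

text \<open>The point \<open>(1 - t)x \<oplus> ty\<close>, for \<open>t \<in> [0,1]\<close>. The description is well defined because
  geodesics in a Hadamard space are unique on \<open>[0,1]\<close>.\<close>

definition geodesic_comb :: "real \<Rightarrow> 'a::hadamard_space \<Rightarrow> 'a \<Rightarrow> 'a"
  where "geodesic_comb t x y = (THE z. \<exists>\<gamma>. geodesic \<gamma> x y \<and> z = \<gamma> t)"

definition proper_fun :: "('a \<Rightarrow> ereal) \<Rightarrow> bool"
  where "proper_fun f \<longleftrightarrow> (\<forall>x. f x \<noteq> -\<infinity>) \<and> {x. f x < \<infinity>} \<noteq> {}"

definition lsc_fun :: "('a::metric_space \<Rightarrow> ereal) \<Rightarrow> bool"
  where "lsc_fun f \<longleftrightarrow> (\<forall>u X. X \<longlonglongrightarrow> u \<longrightarrow> f u \<le> liminf (\<lambda>n. f (X n)))"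

definition convex_fun :: "('a::hadamard_space \<Rightarrow> ereal) \<Rightarrow> bool"
  where "convex_fun f \<longleftrightarrow> (\<forall>x y. \<forall>t\<in>{0<..<1}.
    f (geodesic_comb t x y) \<le> ereal (1 - t) * f x + ereal t * f y)"

definition argmins :: "('a \<Rightarrow> ereal) \<Rightarrow> 'a set"
  where "argmins g = {y. is_arg_min g (\<lambda>_. True) y}"

definition resolvent :: "real \<Rightarrow> ('a::metric_space \<Rightarrow> ereal) \<Rightarrow> 'a \<Rightarrow> 'a"
  where "resolvent l f x =
    (THE y. y \<in> argmins (\<lambda>y. f y + ereal (1 / (2 * l) * (dist x y)\<^sup>2)))"

text \<open>\<open>limsup\<close> is taken in the extended reals; for bounded sequences it is finite.\<close>

definition asymptotic_center :: "(nat \<Rightarrow> 'a::metric_space) \<Rightarrow> 'a set"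
  where "asymptotic_center X =
    {z. limsup (\<lambda>n. ereal (dist z (X n))) = (INF y. limsup (\<lambda>n. ereal (dist y (X n))))}"

definition Delta_convergent :: "(nat \<Rightarrow> 'a::metric_space) \<Rightarrow> 'a \<Rightarrow> bool"
  where "Delta_convergent X z \<longleftrightarrow> bounded (range X) \<and>
    (\<forall>r::nat \<Rightarrow> nat. strict_mono r \<longrightarrow> asymptotic_center (X \<circ> r) = {z})"

text \<open>\<open>R\<^bsub>l m\<^esub> \<dots> R\<^bsub>l 1\<^esub>\<close>: \<open>fold\<close> applies the mapping of the head of the list first.\<close>

definition resolvent_product :: "(nat \<Rightarrow> real) \<Rightarrow> nat \<Rightarrow> ('a::metric_space \<Rightarrow> ereal) \<Rightarrow> 'a \<Rightarrow> 'a"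
  where "resolvent_product l m f = fold (\<lambda>i. resolvent (l i) f) [1..<Suc m]"

end

theory Submission
  imports Defs
begin

text \<open>Write \<open>\<mu>\<close> for the minimum of \<open>f\<close>, \<open>T\<close> for the product of the resolvents and
  \<open>x\<^sub>n = T\<^sup>n x\<^sub>0\<close>. All the geometry that the proof needs is contained in the CN inequality, which
  says that squared distances are as convex along geodesics as they are in Euclidean space
  (\<open>CN_inequality\<close>). Comparing the minimizer \<open>z = R\<^bsub>\<lambda>\<^esub> x\<close> with points of the geodesic from \<open>z\<close>
  to an arbitrary \<open>y\<close>, and letting these points tend to \<open>z\<close>, turns convexity of \<open>f\<close> into
  \<open>2\<lambda> (f z - f y) \<le> d(x,y)\<^sup>2 - d(x,z)\<^sup>2 - d(z,y)\<^sup>2\<close> (\<open>resolvent_inequality\<close>). This inequality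
  is used twice.

  With \<open>y\<close> a minimizer \<open>p\<close> of \<open>f\<close>, it shows that resolvents do not increase the distance to \<open>p\<close>,
  and that \<open>2\<lambda>\<^sub>m (f (T x) - \<mu>) \<le> d(x,p)\<^sup>2 - d(T x,p)\<^sup>2\<close>, where only the resolvent applied last
  matters (\<open>resolvent_product_Fejer\<close>). So \<open>d(x\<^sub>n,p)\<close> is decreasing, hence convergent, for every
  minimizer \<open>p\<close>, and the differences \<open>d(x\<^sub>n,p)\<^sup>2 - d(x\<^sub>n\<^sub>+\<^sub>1,p)\<^sup>2\<close> tend to \<open>0\<close>; therefore
  \<open>f x\<^sub>n\<close> tends to \<open>\<mu>\<close>.

  With \<open>x\<close> the asymptotic center of a bounded sequence \<open>u\<^sub>n\<close> such that \<open>f u\<^sub>n\<close> tends to \<open>\<mu>\<close>, and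
  \<open>y = u\<^sub>n\<close>, it shows that the resolvent of the center is asymptotically at least as close to the
  sequence as the center itself. The center is therefore a fixed point of the resolvent, that is,
  a minimizer of \<open>f\<close> (\<open>asymptotic_center_minimizing\<close>).

  Hence the asymptotic centers \<open>z\<close> of \<open>x\<^sub>n\<close> and \<open>w\<close> of a subsequence are both minimizers. Since the
  distances from \<open>x\<^sub>n\<close> to a minimizer converge, passing to the subsequence does not change their
  upper limits; so \<open>z\<close> is at least as good a center of the subsequence as \<open>w\<close>, and uniqueness of
  asymptotic centers gives \<open>z = w\<close> (\<open>Fejer_minimizing_Delta_convergent\<close>).\<close>

section \<open>Comparison triangles and the CN inequality\<close>

lemma dist_convex_combination_squared:
  fixes x y p :: "'b::real_inner"
  shows "(dist p ((1 - t) *\<^sub>R x + t *\<^sub>R y))\<^sup>2 =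
    (1 - t) * (dist p x)\<^sup>2 + t * (dist p y)\<^sup>2 - t * (1 - t) * (dist x y)\<^sup>2"
  unfolding dist_norm power2_norm_eq_inner
  by (simp add: inner_simps inner_commute power2_eq_square algebra_simps)

lemma dist_vector_2_squared:
  "(dist (vector [a, b] :: real^2) (vector [c, d]))\<^sup>2 = (a - c)\<^sup>2 + (b - d)\<^sup>2"
  unfolding dist_norm power2_norm_eq_inner
  by (simp add: inner_vec_def UNIV_2 power2_eq_square)

text \<open>The triangle inequalities are exactly what makes the law of cosines solvable: if \<open>p \<noteq> q\<close>, put \<open>p'\<close> at the
  origin and \<open>q'\<close> on the first axis; then \<open>r'\<close> must have first coordinate
  \<open>(a\<^sup>2 + b\<^sup>2 - c\<^sup>2) / (2a)\<close>, whose modulus is at most \<open>b\<close>.\<close>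

lemma comparison_triangle_exists:
  fixes p q r :: "'a::metric_space"
  obtains p' q' r' :: "real^2"
  where "dist p' q' = dist p q" "dist q' r' = dist q r" "dist r' p' = dist r p"
proof (cases "p = q")
  case True
  let ?o = "vector [0, 0] :: real^2"
  let ?r = "vector [dist p r, 0] :: real^2"
  have "(dist ?o ?r)\<^sup>2 = (dist p r)\<^sup>2"
    by (simp add: dist_vector_2_squared)
  then have "dist ?o ?r = dist p r"
    by (simp add: power2_eq_iff_nonneg)
  then show thesis
    using that[of ?o ?o ?r] True by (simp add: dist_commute)
next
  case False
  define a b c where "a = dist p q" and "b = dist r p" and "c = dist q r"
  define x where "x = (a\<^sup>2 + b\<^sup>2 - c\<^sup>2) / (2 * a)"
  have "a > 0" "b \<ge> 0" "c \<ge> 0"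
    using False by (auto simp: a_def b_def c_def)
  have tri: "a \<le> b + c" "b \<le> a + c" "c \<le> a + b"
    unfolding a_def b_def c_def
    using dist_triangle[of p q r] dist_triangle[of r p q] dist_triangle[of q r p]
    by (simp_all add: dist_commute)
  have ax: "2 * a * x = a\<^sup>2 + b\<^sup>2 - c\<^sup>2"
    using \<open>a > 0\<close> by (simp add: x_def)
  have "(a - b)\<^sup>2 \<le> c\<^sup>2" "c\<^sup>2 \<le> (a + b)\<^sup>2"
    using tri \<open>a > 0\<close> \<open>b \<ge> 0\<close> \<open>c \<ge> 0\<close> by (simp_all add: abs_le_square_iff [symmetric])
  then have "2 * a * x \<le> 2 * a * b" "2 * a * (- b) \<le> 2 * a * x"
    unfolding ax by (simp_all add: power2_eq_square algebra_simps)
  then have "x \<le> b" "- b \<le> x"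
    using \<open>a > 0\<close> mult_le_cancel_left_pos[of "2 * a" x b] mult_le_cancel_left_pos[of "2 * a" "- b" x]
    by simp_all
  then have "\<bar>x\<bar> \<le> b"
    by simp
  then have x2: "x\<^sup>2 \<le> b\<^sup>2"
    by (simp add: abs_le_square_iff [symmetric])
  let ?p = "vector [0, 0] :: real^2"
  let ?q = "vector [a, 0] :: real^2"
  let ?r = "vector [x, sqrt (b\<^sup>2 - x\<^sup>2)] :: real^2"
  have "(dist ?p ?q)\<^sup>2 = a\<^sup>2" "(dist ?r ?p)\<^sup>2 = b\<^sup>2"
    using x2 by (simp_all add: dist_vector_2_squared)
  moreover have "(dist ?q ?r)\<^sup>2 = c\<^sup>2"
  proof -
    have "(dist ?q ?r)\<^sup>2 = a\<^sup>2 - 2 * a * x + b\<^sup>2"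
      using x2 by (simp add: dist_vector_2_squared power2_diff)
    then show ?thesis using ax by simp
  qed
  ultimately have "dist ?p ?q = a" "dist ?q ?r = c" "dist ?r ?p = b"
    using \<open>a > 0\<close> \<open>b \<ge> 0\<close> \<open>c \<ge> 0\<close> by (simp_all add: power2_eq_iff_nonneg)
  then show thesis
    using that by (simp add: a_def b_def c_def)
qed

lemma geodesic_dist:
  assumes "geodesic \<gamma> x y" "t \<in> {0..1}"
  shows "dist x (\<gamma> t) = t * dist x y" "dist (\<gamma> t) y = (1 - t) * dist x y"
proof -
  from assms(1) have "\<gamma> 0 = x" "\<gamma> 1 = y"
    and d: "\<And>s t. s \<in> {0..1} \<Longrightarrow> t \<in> {0..1} \<Longrightarrow> dist (\<gamma> t) (\<gamma> s) = dist x y * \<bar>t - s\<bar>"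
    by (auto simp: geodesic_def)
  then show "dist x (\<gamma> t) = t * dist x y" "dist (\<gamma> t) y = (1 - t) * dist x y"
    using d[of t 0] d[of 1 t] assms(2) by (auto simp: dist_commute)
qed

text \<open>The point \<open>p\<close> and the point \<open>\<gamma> t\<close> of the opposite side are at most as far apart as their
  comparison points, and in the Euclidean plane the inequality is an equality (Stewart's theorem).\<close>

theorem CN_inequality:
  fixes x y p :: "'a::hadamard_space"
  assumes \<gamma>: "geodesic \<gamma> x y" and t: "t \<in> {0..1}"
  shows "(dist p (\<gamma> t))\<^sup>2 \<le>
    (1 - t) * (dist p x)\<^sup>2 + t * (dist p y)\<^sup>2 - t * (1 - t) * (dist x y)\<^sup>2"
proof -
  obtain \<gamma>2 \<gamma>3 where \<gamma>2: "geodesic \<gamma>2 y p" and \<gamma>3: "geodesic \<gamma>3 p x"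
    using geodesic_exists by blast
  obtain x' y' p' :: "real^2" where cmp:
    "dist x' y' = dist x y" "dist y' p' = dist y p" "dist p' x' = dist p x"
    using comparison_triangle_exists .
  define u' where "u' = (1 - t) *\<^sub>R x' + t *\<^sub>R y'"
  have "x' - u' = t *\<^sub>R (x' - y')"
    by (simp add: u'_def algebra_simps)
  then have "dist x' u' = t * dist x' y'"
    using t by (simp add: dist_norm)
  then have "comparison_point (\<gamma> ` {0..1}) x x' y' (\<gamma> t) u'"
    using t geodesic_dist(1)[OF \<gamma> t] cmp(1)
    by (auto simp: comparison_point_def u'_def closed_segment_def)
  moreover have "p \<in> \<gamma>3 ` {0..1}"
    using \<gamma>3 by (force simp: geodesic_def)
  then have "comparison_point (\<gamma>3 ` {0..1}) p p' x' p p'"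
    by (simp add: comparison_point_def)
  moreover have "geodesic_segment (\<gamma> ` {0..1}) x y" "geodesic_segment (\<gamma>2 ` {0..1}) y p"
      "geodesic_segment (\<gamma>3 ` {0..1}) p x"
    using \<gamma> \<gamma>2 \<gamma>3 by (auto simp: geodesic_segment_def)
  ultimately have "dist p (\<gamma> t) \<le> dist p' u'"
    using CAT0_inequality[where ?S1.0 = "\<gamma> ` {0..1}" and ?S2.0 = "\<gamma>2 ` {0..1}"
        and ?S3.0 = "\<gamma>3 ` {0..1}", OF _ _ _ cmp, of p p' "\<gamma> t" u'] by simp
  then have "(dist p (\<gamma> t))\<^sup>2 \<le> (dist p' u')\<^sup>2"
    by (simp add: power_mono)
  also have "\<dots> = (1 - t) * (dist p x)\<^sup>2 + t * (dist p y)\<^sup>2 - t * (1 - t) * (dist x y)\<^sup>2"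
    unfolding u'_def dist_convex_combination_squared using cmp by (simp add: dist_commute)
  finally show ?thesis .
qed

text \<open>Apply the CN inequality to the first geodesic, with the point of the second one as \<open>p\<close>: its
  distances to the end points are so small that the right-hand side vanishes.\<close>

lemma geodesic_unique:
  fixes x y :: "'a::hadamard_space"
  assumes \<gamma>: "geodesic \<gamma> x y" "geodesic \<gamma>' x y" and t: "t \<in> {0..1}"
  shows "\<gamma> t = \<gamma>' t"
proof -
  let ?p = "\<gamma>' t"
  have "(dist ?p (\<gamma> t))\<^sup>2 \<le>
    (1 - t) * (dist ?p x)\<^sup>2 + t * (dist ?p y)\<^sup>2 - t * (1 - t) * (dist x y)\<^sup>2"
    by (rule CN_inequality) fact+
  also have "dist ?p x = t * dist x y"
    using geodesic_dist[OF \<gamma>(2) t] by (simp add: dist_commute)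
  also have "dist ?p y = (1 - t) * dist x y"
    using geodesic_dist[OF \<gamma>(2) t] by simp
  also have "(1 - t) * (t * dist x y)\<^sup>2 + t * ((1 - t) * dist x y)\<^sup>2 - t * (1 - t) * (dist x y)\<^sup>2 = 0"
    by (simp add: power2_eq_square algebra_simps)
  finally show ?thesis by simp
qed

lemma geodesic_comb_eq:
  fixes x y :: "'a::hadamard_space"
  assumes "geodesic \<gamma> x y" "t \<in> {0..1}"
  shows "geodesic_comb t x y = \<gamma> t"
  unfolding geodesic_comb_def using assms geodesic_unique by (intro the_equality) blast+

lemma CN_inequality_comb:
  fixes x y p :: "'a::hadamard_space"
  assumes "t \<in> {0..1}"
  shows "(dist p (geodesic_comb t x y))\<^sup>2 \<le>
    (1 - t) * (dist p x)\<^sup>2 + t * (dist p y)\<^sup>2 - t * (1 - t) * (dist x y)\<^sup>2"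
  using geodesic_exists[of x y] CN_inequality[of _ x y t p] geodesic_comb_eq[of _ x y t] assms
  by auto

section \<open>Minimizers of uniformly convex functions\<close>

text \<open>The last hypothesis is a form of uniform convexity that only refers to sublevel sets: two points
  of a sublevel set give a point (in the applications, their midpoint) in a lower one, by an amount
  quadratic in their distance. Sublevels close to the infimum are therefore small, so every
  minimizing sequence is Cauchy, and two minimizers coincide. Both resolvents and asymptotic centers
  are obtained from this.\<close>

lemma uniformly_convex_minimizer:
  fixes F :: "'a::complete_space \<Rightarrow> ereal"
  assumes lsc: "lsc_fun F" and bdd: "\<And>x. ereal b \<le> F x" and fin: "F x0 < \<infinity>" and "c > 0"
    and cvx: "\<And>x y r. F x \<le> ereal r \<Longrightarrow> F y \<le> ereal r \<Longrightarrow>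
      \<exists>w. F w \<le> ereal (r - c * (dist x y)\<^sup>2)"
  shows "\<exists>!z. z \<in> argmins F"
proof -
  define I where "I = (INF x. F x)"
  have "ereal b \<le> I" "I \<le> F x0"
    unfolding I_def using bdd by (auto intro: INF_greatest INF_lower)
  then obtain i where i: "I = ereal i"
    using fin by (cases I) auto
  have lower: "ereal i \<le> F x" for x
    unfolding i[symmetric] I_def by (auto intro: INF_lower)
  \<comment> \<open>The point given by uniform convexity cannot lie below the infimum, which bounds the diameter
    of the sublevel set of \<open>i + e\<close>.\<close>
  have near: "(dist x y)\<^sup>2 \<le> e / c" if le: "F x \<le> ereal (i + e)" "F y \<le> ereal (i + e)" for x y e
  proof -
    obtain w where "F w \<le> ereal (i + e - c * (dist x y)\<^sup>2)"
      using cvx[OF le] by blast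
    with lower[of w] have "ereal i \<le> ereal (i + e - c * (dist x y)\<^sup>2)"
      by (rule order_trans)
    then show ?thesis
      using \<open>c > 0\<close> by (simp add: field_simps)
  qed
  have "\<exists>x. F x \<le> ereal (i + inverse (real (Suc n)))" for n
  proof -
    have "(INF x. F x) < ereal (i + inverse (real (Suc n)))"
      using i by (simp add: I_def[symmetric])
    then show ?thesis
      by (auto simp: INF_less_iff intro: less_imp_le)
  qed
  then obtain X where X: "\<And>n. F (X n) \<le> ereal (i + inverse (real (Suc n)))"
    by metis
  have "Cauchy X"
  proof (rule metric_CauchyI)
    fix e :: real assume "e > 0"
    then obtain N where N: "inverse (real (Suc N)) < c * e\<^sup>2"
      using reals_Archimedean[of "c * e\<^sup>2"] \<open>c > 0\<close> by auto
    have *: "F (X n) \<le> ereal (i + inverse (real (Suc N)))" if "n \<ge> N" for n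
      using that by (intro order_trans[OF X]) (simp add: field_simps)
    have "dist (X n) (X k) < e" if "n \<ge> N" "k \<ge> N" for n k
    proof -
      have "(dist (X n) (X k))\<^sup>2 \<le> inverse (real (Suc N)) / c"
        using near * that by blast
      also have "\<dots> < e\<^sup>2"
        using N \<open>c > 0\<close> by (simp add: pos_divide_less_eq mult.commute)
      finally show ?thesis
        using \<open>e > 0\<close> power2_less_imp_less[of "dist (X n) (X k)" e] by simp
    qed
    then show "\<exists>N. \<forall>n\<ge>N. \<forall>k\<ge>N. dist (X n) (X k) < e" by blast
  qed
  then obtain z where z: "X \<longlonglongrightarrow> z"
    using Cauchy_convergent convergent_def by blast
  have "F z \<le> liminf (\<lambda>n. F (X n))"
    using lsc z by (auto simp: lsc_fun_def)
  also have "\<dots> \<le> liminf (\<lambda>n. ereal (i + inverse (real (Suc n))))"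
    using X by (intro Liminf_mono) simp
  also have "\<dots> = ereal i"
    using tendsto_add[OF tendsto_const[of i] LIMSEQ_inverse_real_of_nat]
    by (intro lim_imp_Liminf) auto
  finally have Fz: "F z \<le> ereal i" .
  have "z \<in> argmins F"
    using Fz lower by (auto simp: argmins_def is_arg_min_def not_less intro: order_trans)
  moreover have "y = z" if "y \<in> argmins F" for y
  proof -
    have "F y \<le> ereal i"
      using that Fz by (auto simp: argmins_def is_arg_min_def not_less intro: order_trans)
    then show ?thesis
      using near[of y 0 z] Fz by simp
  qed
  ultimately show ?thesis by blast
qed

section \<open>Asymptotic centers of bounded sequences\<close>

definition asymptotic_radius_at :: "(nat \<Rightarrow> 'a::metric_space) \<Rightarrow> 'a \<Rightarrow> real"
  where "asymptotic_radius_at X z = real_of_ereal (limsup (\<lambda>n. ereal (dist z (X n))))"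

lemma limsup_dist_eq:
  fixes X :: "nat \<Rightarrow> 'a::metric_space"
  assumes "bounded (range X)"
  shows "limsup (\<lambda>n. ereal (dist z (X n))) = ereal (asymptotic_radius_at X z)"
    and "asymptotic_radius_at X z \<ge> 0"
proof -
  let ?L = "limsup (\<lambda>n. ereal (dist z (X n)))"
  obtain B where "\<And>n. dist z (X n) \<le> B"
    using assms bounded_any_center[of "range X" z] by auto
  then have "?L \<le> ereal B"
    by (intro Limsup_bounded) simp
  moreover have "0 \<le> ?L"
    by (intro le_Limsup) auto
  ultimately show "?L = ereal (asymptotic_radius_at X z)" "asymptotic_radius_at X z \<ge> 0"
    unfolding asymptotic_radius_at_def by (cases ?L; simp)+
qed

text \<open>This lemma and the next one replace computations with upper limits by eventual inequalities
  between squared distances, the form in which the CN inequality and the resolvent inequality are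
  available.\<close>

lemma eventually_dist_squared_le:
  fixes X :: "nat \<Rightarrow> 'a::metric_space"
  assumes "bounded (range X)" "e > 0"
  shows "\<forall>\<^sub>F n in sequentially. (dist z (X n))\<^sup>2 \<le> (asymptotic_radius_at X z)\<^sup>2 + e"
proof -
  let ?a = "asymptotic_radius_at X z"
  have "?a < sqrt (?a\<^sup>2 + e)"
    using assms(2) by (intro real_less_rsqrt) simp
  then have "limsup (\<lambda>n. ereal (dist z (X n))) < ereal (sqrt (?a\<^sup>2 + e))"
    using limsup_dist_eq[OF assms(1)] by simp
  then have "\<forall>\<^sub>F n in sequentially. ereal (dist z (X n)) < ereal (sqrt (?a\<^sup>2 + e))"
    by (rule Limsup_lessD)
  then show ?thesis
  proof eventually_elim
    case (elim n)
    then have "(dist z (X n))\<^sup>2 \<le> (sqrt (?a\<^sup>2 + e))\<^sup>2"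
      by (intro power_mono) auto
    then show ?case using assms(2) by simp
  qed
qed

lemma asymptotic_radius_at_squared_le:
  fixes X :: "nat \<Rightarrow> 'a::metric_space"
  assumes bdd: "bounded (range X)"
    and le: "\<And>e. e > 0 \<Longrightarrow> \<forall>\<^sub>F n in sequentially. (dist z (X n))\<^sup>2 \<le> c + e"
  shows "(asymptotic_radius_at X z)\<^sup>2 \<le> c"
proof (rule field_le_epsilon)
  fix e :: real assume "e > 0"
  from le[OF this] have ev: "\<forall>\<^sub>F n in sequentially. ereal (dist z (X n)) \<le> ereal (sqrt (c + e))"
    by eventually_elim (auto intro: real_le_rsqrt)
  then have "limsup (\<lambda>n. ereal (dist z (X n))) \<le> ereal (sqrt (c + e))"
    by (rule Limsup_bounded)
  then have *: "asymptotic_radius_at X z \<le> sqrt (c + e)"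
    using limsup_dist_eq(1)[OF bdd] by simp
  moreover have "asymptotic_radius_at X z \<ge> 0"
    by (rule limsup_dist_eq(2)[OF bdd])
  ultimately have "0 \<le> c + e"
    by (meson order_trans real_sqrt_ge_0_iff)
  then show "(asymptotic_radius_at X z)\<^sup>2 \<le> c + e"
    using power_mono[OF * \<open>0 \<le> asymptotic_radius_at X z\<close>, of 2] by simp
qed

lemma asymptotic_center_iff:
  fixes X :: "nat \<Rightarrow> 'a::metric_space"
  assumes "bounded (range X)"
  shows "z \<in> asymptotic_center X \<longleftrightarrow>
    (\<forall>y. asymptotic_radius_at X z \<le> asymptotic_radius_at X y)"
proof -
  have "z \<in> asymptotic_center X \<longleftrightarrow>
      ereal (asymptotic_radius_at X z) = (INF y. ereal (asymptotic_radius_at X y))"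
    by (simp add: asymptotic_center_def limsup_dist_eq[OF assms])
  also have "\<dots> \<longleftrightarrow> (\<forall>y. ereal (asymptotic_radius_at X z) \<le> ereal (asymptotic_radius_at X y))"
    by (metis INF_greatest INF_lower UNIV_I antisym)
  finally show ?thesis by simp
qed

lemma asymptotic_radius_at_lipschitz:
  fixes X :: "nat \<Rightarrow> 'a::metric_space"
  assumes "bounded (range X)"
  shows "asymptotic_radius_at X y \<le> asymptotic_radius_at X z + dist y z"
proof -
  have "limsup (\<lambda>n. ereal (dist y (X n))) \<le> limsup (\<lambda>n. ereal (dist y z) + ereal (dist z (X n)))"
    by (intro Limsup_mono) (simp add: dist_triangle)
  also have "\<dots> = ereal (dist y z) + limsup (\<lambda>n. ereal (dist z (X n)))"
    by (intro Limsup_add_ereal_left) auto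
  finally show ?thesis
    by (simp add: limsup_dist_eq[OF assms])
qed

text \<open>The radius itself need not be uniformly convex, but its square is, since the CN
  inequality survives the passage to the upper limit; and both have the same minimizers.\<close>

theorem asymptotic_center_singleton:
  fixes X :: "nat \<Rightarrow> 'a::hadamard_space"
  assumes bdd: "bounded (range X)"
  shows "\<exists>z. asymptotic_center X = {z}"
proof -
  let ?r = "asymptotic_radius_at X"
  have r0: "?r z \<ge> 0" for z
    by (rule limsup_dist_eq(2)[OF bdd])
  define F where "F z = ereal ((?r z)\<^sup>2)" for z
  have "\<exists>!z. z \<in> argmins F"
  proof (rule uniformly_convex_minimizer[where b = 0 and c = "1/4"])
    show "lsc_fun F"
      unfolding lsc_fun_def
    proof (intro allI impI)
      fix u :: 'a and Y assume Y: "Y \<longlonglongrightarrow> u"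
      have "(\<lambda>n. ?r (Y n)) \<longlonglongrightarrow> ?r u"
      proof (rule LIM_zero_cancel, rule Lim_null_comparison)
        show "(\<lambda>n. dist (Y n) u) \<longlonglongrightarrow> 0"
          using Y tendsto_dist_iff by blast
        have "norm (?r (Y n) - ?r u) \<le> dist (Y n) u" for n
          using asymptotic_radius_at_lipschitz[OF bdd, of "Y n" u]
            asymptotic_radius_at_lipschitz[OF bdd, of u "Y n"]
          by (simp add: dist_commute abs_le_iff)
        then show "\<forall>\<^sub>F n in sequentially. norm (?r (Y n) - ?r u) \<le> dist (Y n) u"
          by simp
      qed
      then have "(\<lambda>n. F (Y n)) \<longlonglongrightarrow> F u"
        unfolding F_def by (intro tendsto_intros)
      then show "F u \<le> liminf (\<lambda>n. F (Y n))"
        by (simp add: lim_imp_Liminf)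
    qed
    show "\<exists>w. F w \<le> ereal (s - 1/4 * (dist x y)\<^sup>2)" if "F x \<le> ereal s" "F y \<le> ereal s" for x y s
    proof
      let ?w = "geodesic_comb (1/2) x y"
      have "(?r ?w)\<^sup>2 \<le> s - 1/4 * (dist x y)\<^sup>2"
      proof (rule asymptotic_radius_at_squared_le[OF bdd])
        fix e :: real assume "e > 0"
        from eventually_dist_squared_le[OF bdd this, of x] eventually_dist_squared_le[OF bdd this, of y]
        show "\<forall>\<^sub>F n in sequentially. (dist ?w (X n))\<^sup>2 \<le> s - 1/4 * (dist x y)\<^sup>2 + e"
        proof eventually_elim
          case (elim n)
          have "(?r x)\<^sup>2 \<le> s" "(?r y)\<^sup>2 \<le> s"
            using that by (auto simp: F_def)
          then show ?case
            using CN_inequality_comb[of "1/2" "X n" x y] elim by (simp add: dist_commute)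
        qed
      qed
      then show "F ?w \<le> ereal (s - 1/4 * (dist x y)\<^sup>2)"
        by (simp add: F_def)
    qed
  qed (auto simp: F_def)
  moreover have "asymptotic_center X = argmins F"
    using r0 by (auto simp: asymptotic_center_iff[OF bdd] argmins_def is_arg_min_def F_def not_less)
  ultimately show ?thesis by auto
qed

section \<open>The resolvent inequality\<close>

text \<open>The minimum is a parameter and a real number, so that differences of values of \<open>f\<close> can be handled
  in the reals.\<close>

locale convex_minimization =
  fixes f :: "'a::hadamard_space \<Rightarrow> ereal" and \<mu> :: real
  assumes lsc: "lsc_fun f" and convex: "convex_fun f"
    and lower_bound: "ereal \<mu> \<le> f x" and attained: "\<exists>p. f p = ereal \<mu>"
begin

lemma in_argmins_iff: "z \<in> argmins f \<longleftrightarrow> f z \<le> ereal \<mu>"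
  using lower_bound attained
  by (auto simp: argmins_def is_arg_min_def not_less intro: order_trans)
    (metis)

lemma convexD:
  assumes "f x \<le> ereal a" "f y \<le> ereal b" "t \<in> {0<..<1}"
  shows "f (geodesic_comb t x y) \<le> ereal ((1 - t) * a + t * b)"
proof -
  have "f (geodesic_comb t x y) \<le> ereal (1 - t) * f x + ereal t * f y"
    using convex assms(3) by (auto simp: convex_fun_def)
  also have "\<dots> \<le> ereal (1 - t) * ereal a + ereal t * ereal b"
    using assms by (intro add_mono ereal_mult_left_mono) auto
  finally show ?thesis by simp
qed

text \<open>The quadratic term makes the objective uniformly convex: at the midpoint of \<open>y\<close> and \<open>z\<close> it gains
  \<open>d(y,z)\<^sup>2 / 4\<close> by the CN inequality, and the factor \<open>1 / (2l)\<close> turns this into \<open>1 / (8l)\<close>.\<close>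

theorem resolvent_in_argmins:
  assumes l: "l > 0"
  shows "resolvent l f x \<in> argmins (\<lambda>y. f y + ereal (1 / (2 * l) * (dist x y)\<^sup>2))"
proof -
  let ?q = "\<lambda>y. 1 / (2 * l) * (dist x y)\<^sup>2"
  let ?F = "\<lambda>y. f y + ereal (?q y)"
  obtain p where p: "f p = ereal \<mu>" using attained by blast
  have "\<exists>!z. z \<in> argmins ?F"
  proof (rule uniformly_convex_minimizer[where b = \<mu> and c = "1 / (8 * l)"])
    show "lsc_fun ?F"
      unfolding lsc_fun_def
    proof (intro allI impI)
      fix u :: 'a and Y assume Y: "Y \<longlonglongrightarrow> u"
      have "(\<lambda>n. ereal (?q (Y n))) \<longlonglongrightarrow> ereal (?q u)"
        by (intro tendsto_intros Y)
      then have q: "liminf (\<lambda>n. ereal (?q (Y n))) = ereal (?q u)"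
        by (simp add: lim_imp_Liminf)
      have f: "f u \<le> liminf (\<lambda>n. f (Y n))"
        using lsc Y by (auto simp: lsc_fun_def)
      have "?F u \<le> liminf (\<lambda>n. f (Y n)) + liminf (\<lambda>n. ereal (?q (Y n)))"
        unfolding q using f by (intro add_right_mono)
      also have "\<dots> \<le> liminf (\<lambda>n. ?F (Y n))"
      proof (rule ereal_liminf_add_mono)
        have "ereal \<mu> \<le> liminf (\<lambda>n. f (Y n))"
          using lower_bound by (intro Liminf_bounded) simp
        then show "\<not> (liminf (\<lambda>n. f (Y n)) = \<infinity> \<and> liminf (\<lambda>n. ereal (?q (Y n))) = - \<infinity> \<or>
            liminf (\<lambda>n. f (Y n)) = - \<infinity> \<and> liminf (\<lambda>n. ereal (?q (Y n))) = \<infinity>)"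
          unfolding q by auto
      qed
      finally show "?F u \<le> liminf (\<lambda>n. ?F (Y n))" .
    qed
    show "ereal \<mu> \<le> ?F y" for y
      using add_mono[OF lower_bound[of y], of 0 "ereal (?q y)"] l by simp
    show "?F p < \<infinity>" using p by simp
    show "\<exists>w. ?F w \<le> ereal (r - 1 / (8 * l) * (dist y z)\<^sup>2)"
      if "?F y \<le> ereal r" "?F z \<le> ereal r" for y z r
    proof
      let ?w = "geodesic_comb (1/2) y z"
      have fy: "f y \<le> ereal (r - ?q y)" and fz: "f z \<le> ereal (r - ?q z)"
        using that by (cases "f y"; cases "f z"; simp)+
      have "f ?w \<le> ereal ((1 - 1/2) * (r - ?q y) + 1/2 * (r - ?q z))"
        by (rule convexD[OF fy fz]) simp
      moreover have "?q ?w \<le> 1 / (2 * l) * (1/2 * (dist x y)\<^sup>2 + 1/2 * (dist x z)\<^sup>2 - 1/4 * (dist y z)\<^sup>2)"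
        using CN_inequality_comb[of "1/2" x y z] l by (intro mult_left_mono) auto
      ultimately have "?F ?w \<le> ereal ((1 - 1/2) * (r - ?q y) + 1/2 * (r - ?q z)) +
          ereal (1 / (2 * l) * (1/2 * (dist x y)\<^sup>2 + 1/2 * (dist x z)\<^sup>2 - 1/4 * (dist y z)\<^sup>2))"
        by (intro add_mono) auto
      also have "\<dots> = ereal (r - 1 / (8 * l) * (dist y z)\<^sup>2)"
        using l by (simp add: field_simps)
      finally show "?F ?w \<le> ereal (r - 1 / (8 * l) * (dist y z)\<^sup>2)" .
    qed
  qed (use l in auto)
  then show ?thesis
    unfolding resolvent_def by (rule theI')
qed

text \<open>First-order optimality: the minimizer \<open>z\<close> is compared with the point \<open>(1 - t)z \<oplus> ty\<close>. By convexity
  and the CN inequality, the terms without a factor \<open>t\<close> cancel; dividing by \<open>t\<close> leaves the claim with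
  an error \<open>t d(z,y)\<^sup>2\<close>, which disappears as \<open>t\<close> tends to \<open>0\<close>.\<close>

theorem resolvent_inequality:
  assumes l: "l > 0" and y: "f y \<le> ereal b"
  shows "f (resolvent l f x) \<le> ereal (b + ((dist x y)\<^sup>2 - (dist x (resolvent l f x))\<^sup>2
    - (dist (resolvent l f x) y)\<^sup>2) / (2 * l))"
proof -
  define z where "z = resolvent l f x"
  have min: "f z + ereal (1 / (2 * l) * (dist x z)\<^sup>2) \<le> f w + ereal (1 / (2 * l) * (dist x w)\<^sup>2)" for w
    using resolvent_in_argmins[OF l, of x] by (auto simp: z_def argmins_def is_arg_min_def not_less)
  have "f z + ereal (1 / (2 * l) * (dist x z)\<^sup>2) \<le> ereal b + ereal (1 / (2 * l) * (dist x y)\<^sup>2)"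
    using min[of y] add_right_mono[OF y] by (rule order_trans)
  \<comment> \<open>The minimal value is bounded above by a real number, so the real inequality below makes
    sense.\<close>
  then obtain a where a: "f z = ereal a"
    using lower_bound[of z] by (cases "f z") auto
  let ?Q = "(dist x z)\<^sup>2" and ?P = "(dist x y)\<^sup>2" and ?D = "(dist z y)\<^sup>2"
  have ineq: "2 * l * (a - b) + ?Q + ?D - ?P \<le> t * ?D" if t: "t \<in> {0<..<1}" for t
  proof -
    let ?w = "geodesic_comb t z y"
    have "ereal (a + 1 / (2 * l) * ?Q) \<le> f ?w + ereal (1 / (2 * l) * (dist x ?w)\<^sup>2)"
      using min[of ?w] a by simp
    also have "\<dots> \<le> ereal ((1 - t) * a + t * b) +
        ereal (1 / (2 * l) * ((1 - t) * ?Q + t * ?P - t * (1 - t) * ?D))"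
    proof (intro add_mono)
      show "f ?w \<le> ereal ((1 - t) * a + t * b)"
        using a y t by (intro convexD) auto
      show "ereal (1 / (2 * l) * (dist x ?w)\<^sup>2)
          \<le> ereal (1 / (2 * l) * ((1 - t) * ?Q + t * ?P - t * (1 - t) * ?D))"
        using CN_inequality_comb[of t x z y] t l
        unfolding ereal_less_eq by (intro mult_left_mono) auto
    qed
    finally have "2 * l * (a + 1 / (2 * l) * ?Q) \<le> 2 * l * ((1 - t) * a + t * b +
        1 / (2 * l) * ((1 - t) * ?Q + t * ?P - t * (1 - t) * ?D))"
      using l by (intro mult_left_mono) auto
    then have "2 * l * a + ?Q \<le> 2 * l * ((1 - t) * a + t * b) +
        ((1 - t) * ?Q + t * ?P - t * (1 - t) * ?D)"
      using l by (simp only: distrib_left) (simp add: algebra_simps)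
    then have "t * (2 * l * (a - b) + ?Q + ?D - ?P) \<le> t * (t * ?D)"
      by (simp add: algebra_simps)
    then show ?thesis
      using t by simp
  qed
  have "2 * l * (a - b) + ?Q + ?D - ?P \<le> 0"
  proof (rule tendsto_lowerbound)
    have "((\<lambda>t. t * ?D) \<longlongrightarrow> 0 * ?D) (at_right 0)"
      by (intro tendsto_intros)
    then show "((\<lambda>t. t * ?D) \<longlongrightarrow> 0) (at_right 0)" by simp
    show "\<forall>\<^sub>F t in at_right 0. 2 * l * (a - b) + ?Q + ?D - ?P \<le> t * ?D"
      using ineq eventually_at_right_real[of 0 1] by (auto elim: eventually_mono)
  qed simp
  then have "a \<le> b + (?P - ?Q - ?D) / (2 * l)"
    using l by (simp add: field_simps)
  then show ?thesis
    using a by (simp add: z_def)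
qed

lemma resolvent_Fejer:
  assumes l: "l > 0" and p: "f p \<le> ereal \<mu>"
  shows "f (resolvent l f x) \<le> ereal (\<mu> + ((dist x p)\<^sup>2 - (dist (resolvent l f x) p)\<^sup>2) / (2 * l))"
    and "dist (resolvent l f x) p \<le> dist x p"
proof -
  let ?z = "resolvent l f x"
  have "f ?z \<le> ereal (\<mu> + ((dist x p)\<^sup>2 - (dist x ?z)\<^sup>2 - (dist ?z p)\<^sup>2) / (2 * l))"
    by (rule resolvent_inequality[OF assms])
  also have "\<dots> \<le> ereal (\<mu> + ((dist x p)\<^sup>2 - (dist ?z p)\<^sup>2) / (2 * l))"
    using l by (auto intro!: divide_right_mono)
  finally show *: "f ?z \<le> ereal (\<mu> + ((dist x p)\<^sup>2 - (dist ?z p)\<^sup>2) / (2 * l))" .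
  from order_trans[OF lower_bound this] have "(dist ?z p)\<^sup>2 \<le> (dist x p)\<^sup>2"
    using l by (simp add: zero_le_divide_iff)
  then show "dist ?z p \<le> dist x p"
    by (rule power2_le_imp_le) simp
qed

lemma fold_resolvent_Fejer:
  assumes "\<And>i. i \<in> set is \<Longrightarrow> l i > 0" "f p \<le> ereal \<mu>"
  shows "dist (fold (\<lambda>i. resolvent (l i) f) is x) p \<le> dist x p"
  using assms(1)
proof (induction "is" arbitrary: x)
  case (Cons i "is")
  then have "dist (fold (\<lambda>i. resolvent (l i) f) is (resolvent (l i) f x)) p
      \<le> dist (resolvent (l i) f x) p"
    by simp
  also have "\<dots> \<le> dist x p"
    using Cons.prems assms(2) by (intro resolvent_Fejer) auto
  finally show ?case by simp
qed simp

text \<open>The first \<open>m - 1\<close> resolvents only have to be nonexpansive towards \<open>p\<close>; the decrease in \<open>f\<close> is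
  due to the last one, because \<open>f\<close> is evaluated at its output.\<close>

lemma resolvent_product_Fejer:
  assumes m: "m \<ge> 1" and l: "\<And>i. i \<in> {1..m} \<Longrightarrow> l i > 0" and p: "f p \<le> ereal \<mu>"
  shows "f (resolvent_product l m f x) \<le>
      ereal (\<mu> + ((dist x p)\<^sup>2 - (dist (resolvent_product l m f x) p)\<^sup>2) / (2 * l m))"
    and "dist (resolvent_product l m f x) p \<le> dist x p"
proof -
  define y where "y = fold (\<lambda>i. resolvent (l i) f) [1..<m] x"
  have T: "resolvent_product l m f x = resolvent (l m) f y"
    using m by (simp add: resolvent_product_def y_def)
  have lm: "l m > 0" using l m by simp
  have yx: "dist y p \<le> dist x p"
    unfolding y_def using l p by (intro fold_resolvent_Fejer) auto
  have "f (resolvent (l m) f y) \<le>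
      ereal (\<mu> + ((dist y p)\<^sup>2 - (dist (resolvent (l m) f y) p)\<^sup>2) / (2 * l m))"
    by (rule resolvent_Fejer[OF lm p])
  also have "\<dots> \<le> ereal (\<mu> + ((dist x p)\<^sup>2 - (dist (resolvent (l m) f y) p)\<^sup>2) / (2 * l m))"
    using lm yx by (auto intro!: divide_right_mono power_mono)
  finally show "f (resolvent_product l m f x) \<le>
      ereal (\<mu> + ((dist x p)\<^sup>2 - (dist (resolvent_product l m f x) p)\<^sup>2) / (2 * l m))"
    by (simp add: T)
  show "dist (resolvent_product l m f x) p \<le> dist x p"
    unfolding T using resolvent_Fejer(2)[OF lm p] yx by (rule order_trans)
qed

section \<open>Delta-convergence of Fejer monotone minimizing sequences\<close>

text \<open>This replaces the usual argument that lower semicontinuous convex functions are lower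
  semicontinuous for \<open>\<Delta>\<close>-convergence. By the resolvent inequality, the squared asymptotic radius at
  the resolvent \<open>w\<close> of \<open>z\<close> is smaller than the one at \<open>z\<close> by at least \<open>d(z,w)\<^sup>2\<close>; as \<open>z\<close> is a center,
  \<open>w = z\<close>. A fixed point of the resolvent is a minimizer, again by the resolvent inequality. The
  parameter \<open>1\<close> of the resolvent is an arbitrary choice.\<close>

lemma asymptotic_center_minimizing:
  assumes bdd: "bounded (range X)" and z: "z \<in> asymptotic_center X"
    and min: "\<And>e. e > 0 \<Longrightarrow> \<forall>\<^sub>F n in sequentially. f (X n) \<le> ereal (\<mu> + e)"
  shows "z \<in> argmins f"
proof -
  define w where "w = resolvent 1 f z"
  have "(asymptotic_radius_at X w)\<^sup>2 \<le> (asymptotic_radius_at X z)\<^sup>2 - (dist z w)\<^sup>2"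
  proof (rule asymptotic_radius_at_squared_le[OF bdd])
    fix e :: real assume "e > 0"
    then have "e / 2 > 0" "e / 4 > 0" by auto
    from eventually_dist_squared_le[OF bdd this(1), of z] min[OF this(2)]
    show "\<forall>\<^sub>F n in sequentially. (dist w (X n))\<^sup>2 \<le> (asymptotic_radius_at X z)\<^sup>2 - (dist z w)\<^sup>2 + e"
    proof eventually_elim
      case (elim n)
      have "f w \<le> ereal (\<mu> + e/4 + ((dist z (X n))\<^sup>2 - (dist z w)\<^sup>2 - (dist w (X n))\<^sup>2) / (2 * 1))"
        unfolding w_def using elim by (intro resolvent_inequality) auto
      from order_trans[OF lower_bound this]
      have "0 \<le> e/4 + ((dist z (X n))\<^sup>2 - (dist z w)\<^sup>2 - (dist w (X n))\<^sup>2) / 2"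
        by simp
      then show ?case
        using elim(1) by argo
    qed
  qed
  moreover have "(asymptotic_radius_at X z)\<^sup>2 \<le> (asymptotic_radius_at X w)\<^sup>2"
    using z limsup_dist_eq(2)[OF bdd] by (intro power_mono) (auto simp: asymptotic_center_iff[OF bdd])
  ultimately have "(dist z w)\<^sup>2 \<le> 0"
    by linarith
  then have wz: "w = z"
    by simp
  obtain p where "f p = ereal \<mu>"
    using attained by blast
  then have p: "f p \<le> ereal \<mu>"
    by simp
  have "f z \<le> ereal \<mu>"
    using resolvent_Fejer(1)[of 1 p z] p wz by (simp add: w_def)
  then show ?thesis by (simp add: in_argmins_iff)
qed

text \<open>A version of Opial's argument. Monotonicity makes the distances to each minimizer converge, so
  the asymptotic radius at a minimizer is the same for the sequence and for all its subsequences;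
  and all the asymptotic centers in question are minimizers.\<close>

theorem Fejer_minimizing_Delta_convergent:
  assumes Fejer: "\<And>p n. p \<in> argmins f \<Longrightarrow> dist (X (Suc n)) p \<le> dist (X n) p"
    and min: "\<And>e. e > 0 \<Longrightarrow> \<forall>\<^sub>F n in sequentially. f (X n) \<le> ereal (\<mu> + e)"
  shows "\<exists>z\<in>argmins f. Delta_convergent X z"
proof -
  have dec: "decseq (\<lambda>n. dist (X n) p)" if "p \<in> argmins f" for p
    using Fejer[OF that] by (rule decseq_SucI)
  obtain p where "f p = ereal \<mu>"
    using attained by blast
  then have p: "p \<in> argmins f"
    by (simp add: in_argmins_iff)
  have bdd: "bounded (range X)"
    unfolding bounded_def using decseqD[OF dec[OF p], of 0]
    by (intro exI[of _ p] exI[of _ "dist (X 0) p"]) (auto simp: dist_commute)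
  obtain z where z: "asymptotic_center X = {z}"
    using asymptotic_center_singleton[OF bdd] by blast
  have zmin: "z \<in> argmins f"
    using asymptotic_center_minimizing[OF bdd _ min] z by blast
  have "asymptotic_center (X \<circ> r) = {z}" if r: "strict_mono r" for r :: "nat \<Rightarrow> nat"
  proof -
    have bdd': "bounded (range (X \<circ> r))"
      using bdd by (rule bounded_subset) auto
    have radius: "asymptotic_radius_at (X \<circ> r) q = asymptotic_radius_at X q" if q: "q \<in> argmins f" for q
    proof -
      obtain L where "(\<lambda>n. dist (X n) q) \<longlonglongrightarrow> L"
        using decseq_convergent[OF dec[OF q], of 0] by auto
      then have L: "(\<lambda>n. ereal (dist q (X n))) \<longlonglongrightarrow> ereal L"
        by (simp add: dist_commute)
      then have L': "(\<lambda>n. ereal (dist q ((X \<circ> r) n))) \<longlonglongrightarrow> ereal L"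
        using LIMSEQ_subseq_LIMSEQ[OF L r] by (simp add: comp_def)
      show ?thesis
        unfolding asymptotic_radius_at_def
        using lim_imp_Limsup[OF _ L] lim_imp_Limsup[OF _ L'] by simp
    qed
    obtain w where w: "asymptotic_center (X \<circ> r) = {w}"
      using asymptotic_center_singleton[OF bdd'] by blast
    have wmin: "w \<in> argmins f"
    proof (rule asymptotic_center_minimizing[OF bdd'])
      show "w \<in> asymptotic_center (X \<circ> r)" using w by simp
      show "\<forall>\<^sub>F n in sequentially. f ((X \<circ> r) n) \<le> ereal (\<mu> + e)" if "e > 0" for e
        using eventually_subseq[OF r min[OF that]] by simp
    qed
    have "asymptotic_radius_at X z \<le> asymptotic_radius_at X w"
      using z asymptotic_center_iff[OF bdd, of z] by simp
    then have "asymptotic_radius_at (X \<circ> r) z \<le> asymptotic_radius_at (X \<circ> r) w"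
      by (simp only: radius[OF zmin] radius[OF wmin])
    moreover have "\<forall>y. asymptotic_radius_at (X \<circ> r) w \<le> asymptotic_radius_at (X \<circ> r) y"
      using w asymptotic_center_iff[OF bdd', of w] by simp
    ultimately have "z \<in> asymptotic_center (X \<circ> r)"
      unfolding asymptotic_center_iff[OF bdd'] by (meson order_trans)
    then show ?thesis using w by simp
  qed
  then show ?thesis
    using zmin bdd by (auto simp: Delta_convergent_def)
qed

end

theorem corollary2:
  fixes f :: "'a::hadamard_space \<Rightarrow> ereal" and l :: "nat \<Rightarrow> real" and m :: nat and x0 :: 'a
  assumes "m \<ge> 1"
    and "proper_fun f" and "lsc_fun f" and "convex_fun f"
    and "\<And>i. i \<in> {1..m} \<Longrightarrow> l i > 0"
    and "argmins f \<noteq> {}"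
  shows "\<exists>xstar\<in>argmins f. Delta_convergent (\<lambda>n. (resolvent_product l m f ^^ n) x0) xstar"
proof -
  obtain p where "p \<in> argmins f" using assms(6) by blast
  then have pmin: "f p \<le> f x" for x
    by (auto simp: argmins_def is_arg_min_def not_less)
  obtain x1 where "f x1 < \<infinity>"
    using assms(2) by (auto simp: proper_fun_def)
  with pmin[of x1] assms(2) obtain \<mu> where \<mu>: "f p = ereal \<mu>"
    by (cases "f p") (auto simp: proper_fun_def)
  interpret convex_minimization f \<mu>
    using assms(3,4) \<mu> pmin by unfold_locales metis+
  define X where "X n = (resolvent_product l m f ^^ n) x0" for n
  have X_Suc: "X (Suc n) = resolvent_product l m f (X n)" for n
    by (simp add: X_def)
  have lm: "l m > 0" using assms(1,5) by simp
  note step = resolvent_product_Fejer[where l = l, OF assms(1,5)]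
  have Fejer: "dist (X (Suc n)) q \<le> dist (X n) q" if "q \<in> argmins f" for q n
    unfolding X_Suc using that by (intro step) (auto simp: in_argmins_iff)
  \<comment> \<open>The decrease of \<open>f\<close> is controlled by consecutive differences of a convergent sequence. The
    bound concerns \<open>X (Suc n)\<close> only: \<open>f\<close> may be infinite at the initial point.\<close>
  have min: "\<forall>\<^sub>F n in sequentially. f (X n) \<le> ereal (\<mu> + e)" if "e > 0" for e
  proof -
    let ?d = "\<lambda>n. (dist (X n) p)\<^sup>2"
    have "decseq (\<lambda>n. dist (X n) p)"
      using Fejer[OF \<open>p \<in> argmins f\<close>] by (rule decseq_SucI)
    then obtain L where L: "(\<lambda>n. dist (X n) p) \<longlonglongrightarrow> L"
      using decseq_convergent[of _ 0] by (metis zero_le_dist)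
    have "(\<lambda>n. (?d n - ?d (Suc n)) / (2 * l m)) \<longlonglongrightarrow> (L\<^sup>2 - L\<^sup>2) / (2 * l m)"
      using lm by (intro tendsto_intros L LIMSEQ_Suc[OF L]) auto
    then have "\<forall>\<^sub>F n in sequentially. (?d n - ?d (Suc n)) / (2 * l m) < e"
      using that by (intro order_tendstoD(2)) auto
    then have "\<forall>\<^sub>F n in sequentially. f (X (Suc n)) \<le> ereal (\<mu> + e)"
    proof eventually_elim
      case (elim n)
      have "f (X (Suc n)) \<le> ereal (\<mu> + (?d n - ?d (Suc n)) / (2 * l m))"
        unfolding X_Suc using \<mu> by (intro step) auto
      also have "\<dots> \<le> ereal (\<mu> + e)"
        using elim by simp
      finally show ?case .
    qed
    then show ?thesis
      using eventually_sequentially_Suc[of "\<lambda>n. f (X n) \<le> ereal (\<mu> + e)"] by simp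
  qed
  show ?thesis
    using Fejer_minimizing_Delta_convergent[OF Fejer min] by (simp add: X_def)
qed

end
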